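(* Let $\mathcal{C}$, $\mathcal{D}$ and $\mathcal{E}$ be abelian categories, let $F:\mathcal{C}\to\mathcal{D}$ and $H:\mathcal{C}\to\mathcal{E}$ be covariant functors, and assume that $F$ is $H$-separable. Then an exact sequence in $\mathcal{C}$ that becomes split after we apply the functor $F$ also becomes split after we apply the functor $H$.
   Context: For covariant functors $F:\mathcal{C}\to\mathcal{D}$ and $H:\mathcal{C}\to\mathcal{E}$, $F$ is called $H$-separable if there is a family of maps $\mathcal{P}_{C,C'}:\mathrm{Hom}_{\mathcal{D}}(F(C),F(C'))\to\mathrm{Hom}_{\mathcal{E}}(H(C),H(C'))$, natural in $C,C'\in\mathcal{C}$ (i.e. $\mathcal{P}_{X,T}(F(v)\circ h\circ F(u))=H(v)\circ\mathcal{P}_{Y,Z}(h)\circ H(u)$ for all $u:X\to Y$, $v:Z\to T$ in $\mathcal{C}$ and $h:F(Y)\to F(Z)$ in $\mathcal{D}$), with $\mathcal{P}_{C,C'}(F(f))=H(f)$ for all $f:C\to C'$ in $\mathcal{C}$. *)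

theory Defs
  imports "HOL-Algebra.Group"
begin

text \<open>
  Categories are given by carrier sets of objects and arrows; in \<open>g \<cdot>\<^bsub>C\<^esub> f\<close> the arrow
  \<open>f\<close> is applied first. All operations are unspecified outside the carriers.
\<close>

record ('o, 'm) category =
  Obj :: "'o set"
  Arr :: "'m set"
  src :: "'m \<Rightarrow> 'o"
  tgt :: "'m \<Rightarrow> 'o"
  ident :: "'o \<Rightarrow> 'm"
  comp :: "'m \<Rightarrow> 'm \<Rightarrow> 'm" (infixl "\<cdot>\<index>" 70)

definition Hom :: "('o, 'm, 'x) category_scheme \<Rightarrow> 'o \<Rightarrow> 'o \<Rightarrow> 'm set" where
  "Hom C X Y = {f \<in> Arr C. src C f = X \<and> tgt C f = Y}"

locale category =
  fixes C :: "('o, 'm, 'x) category_scheme" (structure)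
  assumes src_Obj: "f \<in> Arr C \<Longrightarrow> src C f \<in> Obj C"
    and tgt_Obj: "f \<in> Arr C \<Longrightarrow> tgt C f \<in> Obj C"
    and ident_Hom: "X \<in> Obj C \<Longrightarrow> ident C X \<in> Hom C X X"
    and comp_Hom: "\<lbrakk>f \<in> Hom C X Y; g \<in> Hom C Y Z\<rbrakk> \<Longrightarrow> g \<cdot> f \<in> Hom C X Z"
    and comp_assoc: "\<lbrakk>f \<in> Hom C W X; g \<in> Hom C X Y; h \<in> Hom C Y Z\<rbrakk> \<Longrightarrow> (h \<cdot> g) \<cdot> f = h \<cdot> (g \<cdot> f)"
    and comp_ident: "f \<in> Hom C X Y \<Longrightarrow> f \<cdot> ident C X = f"
    and ident_comp: "f \<in> Hom C X Y \<Longrightarrow> ident C Y \<cdot> f = f"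

definition is_mono :: "('o, 'm, 'x) category_scheme \<Rightarrow> 'm \<Rightarrow> bool" where
  "is_mono C f \<longleftrightarrow> f \<in> Arr C \<and>
    (\<forall>T\<in>Obj C. \<forall>u\<in>Hom C T (src C f). \<forall>v\<in>Hom C T (src C f).
       f \<cdot>\<^bsub>C\<^esub> u = f \<cdot>\<^bsub>C\<^esub> v \<longrightarrow> u = v)"

definition is_epi :: "('o, 'm, 'x) category_scheme \<Rightarrow> 'm \<Rightarrow> bool" where
  "is_epi C f \<longleftrightarrow> f \<in> Arr C \<and>
    (\<forall>T\<in>Obj C. \<forall>u\<in>Hom C (tgt C f) T. \<forall>v\<in>Hom C (tgt C f) T.
       u \<cdot>\<^bsub>C\<^esub> f = v \<cdot>\<^bsub>C\<^esub> f \<longrightarrow> u = v)"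

definition has_left_inverse :: "('o, 'm, 'x) category_scheme \<Rightarrow> 'm \<Rightarrow> bool" where
  "has_left_inverse C f \<longleftrightarrow> f \<in> Arr C \<and>
    (\<exists>r\<in>Hom C (tgt C f) (src C f). r \<cdot>\<^bsub>C\<^esub> f = ident C (src C f))"

definition has_right_inverse :: "('o, 'm, 'x) category_scheme \<Rightarrow> 'm \<Rightarrow> bool" where
  "has_right_inverse C f \<longleftrightarrow> f \<in> Arr C \<and>
    (\<exists>s\<in>Hom C (tgt C f) (src C f). f \<cdot>\<^bsub>C\<^esub> s = ident C (tgt C f))"

definition is_zero_object :: "('o, 'm, 'x) category_scheme \<Rightarrow> 'o \<Rightarrow> bool" where
  "is_zero_object C N \<longleftrightarrow> N \<in> Obj C \<and>
    (\<forall>X\<in>Obj C. (\<exists>!f. f \<in> Hom C X N) \<and> (\<exists>!f. f \<in> Hom C N X))"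


record ('o, 'm) additive_structure = "('o, 'm) category" +
  madd :: "'m \<Rightarrow> 'm \<Rightarrow> 'm" (infixl "\<boxplus>\<index>" 65)
  zero_arr :: "'o \<Rightarrow> 'o \<Rightarrow> 'm"

definition Hom_group :: "('o, 'm, 'x) additive_structure_scheme \<Rightarrow> 'o \<Rightarrow> 'o \<Rightarrow> 'm monoid" where
  "Hom_group C X Y = \<lparr>carrier = Hom C X Y, mult = madd C, one = zero_arr C X Y\<rparr>"

locale preadditive_category = category C
  for C :: "('o, 'm, 'x) additive_structure_scheme" (structure) +
  assumes Hom_comm_group: "\<lbrakk>X \<in> Obj C; Y \<in> Obj C\<rbrakk> \<Longrightarrow> comm_group (Hom_group C X Y)"
    and comp_distrib_left: "\<lbrakk>f \<in> Hom C X Y; f' \<in> Hom C X Y; g \<in> Hom C Y Z\<rbrakk>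
      \<Longrightarrow> g \<cdot> (f \<boxplus> f') = (g \<cdot> f) \<boxplus> (g \<cdot> f')"
    and comp_distrib_right: "\<lbrakk>f \<in> Hom C X Y; g \<in> Hom C Y Z; g' \<in> Hom C Y Z\<rbrakk>
      \<Longrightarrow> (g \<boxplus> g') \<cdot> f = (g \<cdot> f) \<boxplus> (g' \<cdot> f)"

definition is_kernel :: "('o, 'm, 'x) additive_structure_scheme \<Rightarrow> 'm \<Rightarrow> 'm \<Rightarrow> bool" where
  "is_kernel C k f \<longleftrightarrow> k \<in> Arr C \<and> f \<in> Arr C \<and> tgt C k = src C f \<and>
    f \<cdot>\<^bsub>C\<^esub> k = zero_arr C (src C k) (tgt C f) \<and>
    (\<forall>T\<in>Obj C. \<forall>h\<in>Hom C T (src C f). f \<cdot>\<^bsub>C\<^esub> h = zero_arr C T (tgt C f) \<longrightarrow>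
       (\<exists>!u. u \<in> Hom C T (src C k) \<and> k \<cdot>\<^bsub>C\<^esub> u = h))"

definition is_cokernel :: "('o, 'm, 'x) additive_structure_scheme \<Rightarrow> 'm \<Rightarrow> 'm \<Rightarrow> bool" where
  "is_cokernel C c f \<longleftrightarrow> c \<in> Arr C \<and> f \<in> Arr C \<and> src C c = tgt C f \<and>
    c \<cdot>\<^bsub>C\<^esub> f = zero_arr C (src C f) (tgt C c) \<and>
    (\<forall>T\<in>Obj C. \<forall>h\<in>Hom C (tgt C f) T. h \<cdot>\<^bsub>C\<^esub> f = zero_arr C (src C f) T \<longrightarrow>
       (\<exists>!u. u \<in> Hom C (tgt C c) T \<and> u \<cdot>\<^bsub>C\<^esub> c = h))"

definition is_biproduct ::
  "('o, 'm, 'x) additive_structure_scheme \<Rightarrow> 'o \<Rightarrow> 'o \<Rightarrow> 'o \<Rightarrow> 'm \<Rightarrow> 'm \<Rightarrow> 'm \<Rightarrow> 'm \<Rightarrow> bool" where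
  "is_biproduct C X Y B i j p q \<longleftrightarrow> B \<in> Obj C \<and>
    i \<in> Hom C X B \<and> j \<in> Hom C Y B \<and> p \<in> Hom C B X \<and> q \<in> Hom C B Y \<and>
    p \<cdot>\<^bsub>C\<^esub> i = ident C X \<and> q \<cdot>\<^bsub>C\<^esub> j = ident C Y \<and>
    p \<cdot>\<^bsub>C\<^esub> j = zero_arr C Y X \<and> q \<cdot>\<^bsub>C\<^esub> i = zero_arr C X Y \<and>
    (i \<cdot>\<^bsub>C\<^esub> p) \<boxplus>\<^bsub>C\<^esub> (j \<cdot>\<^bsub>C\<^esub> q) = ident C B"

locale abelian_category = preadditive_category C
  for C :: "('o, 'm, 'x) additive_structure_scheme" (structure) +
  assumes zero_object: "\<exists>N. is_zero_object C N"
    and biproducts: "\<lbrakk>X \<in> Obj C; Y \<in> Obj C\<rbrakk> \<Longrightarrow> \<exists>B i j p q. is_biproduct C X Y B i j p q"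
    and kernels: "f \<in> Arr C \<Longrightarrow> \<exists>k. is_kernel C k f"
    and cokernels: "f \<in> Arr C \<Longrightarrow> \<exists>c. is_cokernel C c f"
    and mono_normal: "is_mono C f \<Longrightarrow> \<exists>g. is_kernel C f g"
    and epi_normal: "is_epi C f \<Longrightarrow> \<exists>g. is_cokernel C f g"

text \<open>
  The image of \<open>f\<close> is the kernel of its cokernel; exactness says that one and the same
  subobject \<open>k\<close> is an image of \<open>f\<close> and a kernel of \<open>g\<close>.
\<close>

definition exact_at :: "('o, 'm, 'x) additive_structure_scheme \<Rightarrow> 'm \<Rightarrow> 'm \<Rightarrow> bool" where
  "exact_at C f g \<longleftrightarrow> f \<in> Arr C \<and> g \<in> Arr C \<and> tgt C f = src C g \<and>
    (\<exists>c k. is_cokernel C c f \<and> is_kernel C k c \<and> is_kernel C k g)"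

text \<open>Exactness of \<open>0 \<rightarrow> X \<rightarrow> Y \<rightarrow> Z \<rightarrow> 0\<close> at \<open>X\<close>, \<open>Y\<close> and \<open>Z\<close>, for \<open>f : X \<rightarrow> Y\<close> and \<open>g : Y \<rightarrow> Z\<close>.\<close>

definition short_exact :: "('o, 'm, 'x) additive_structure_scheme \<Rightarrow> 'm \<Rightarrow> 'm \<Rightarrow> bool" where
  "short_exact C f g \<longleftrightarrow> (\<exists>N. is_zero_object C N \<and>
    exact_at C (zero_arr C N (src C f)) f \<and> exact_at C f g \<and>
    exact_at C g (zero_arr C (tgt C g) N))"

text \<open>
  For a short exact sequence either one-sided inverse gives the other. A functor that is not
  additive need not send a short exact sequence to a complex (take a nonzero constant functor),
  so its values on \<open>f\<close> and \<open>g\<close> can be left and right invertible without being \<open>split_exact\<close>.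
\<close>

definition split_exact :: "('o, 'm, 'x) additive_structure_scheme \<Rightarrow> 'm \<Rightarrow> 'm \<Rightarrow> bool" where
  "split_exact C f g \<longleftrightarrow> short_exact C f g \<and> has_left_inverse C f \<and> has_right_inverse C g"


record ('o1, 'm1, 'o2, 'm2) functor_data =
  on_obj :: "'o1 \<Rightarrow> 'o2"
  on_arr :: "'m1 \<Rightarrow> 'm2"

definition covariant_functor ::
  "('o1, 'm1, 'x) category_scheme \<Rightarrow> ('o2, 'm2, 'y) category_scheme \<Rightarrow>
   ('o1, 'm1, 'o2, 'm2) functor_data \<Rightarrow> bool" where
  "covariant_functor C D F \<longleftrightarrow>
    (\<forall>X\<in>Obj C. on_obj F X \<in> Obj D) \<and>
    (\<forall>X\<in>Obj C. \<forall>Y\<in>Obj C. \<forall>f\<in>Hom C X Y. on_arr F f \<in> Hom D (on_obj F X) (on_obj F Y)) \<and>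
    (\<forall>X\<in>Obj C. on_arr F (ident C X) = ident D (on_obj F X)) \<and>
    (\<forall>X\<in>Obj C. \<forall>Y\<in>Obj C. \<forall>Z\<in>Obj C. \<forall>f\<in>Hom C X Y. \<forall>g\<in>Hom C Y Z.
       on_arr F (g \<cdot>\<^bsub>C\<^esub> f) = on_arr F g \<cdot>\<^bsub>D\<^esub> on_arr F f)"

definition additive_functor ::
  "('o1, 'm1, 'x) additive_structure_scheme \<Rightarrow> ('o2, 'm2, 'y) additive_structure_scheme \<Rightarrow>
   ('o1, 'm1, 'o2, 'm2) functor_data \<Rightarrow> bool" where
  "additive_functor C D F \<longleftrightarrow> covariant_functor C D F \<and>
    (\<forall>X\<in>Obj C. \<forall>Y\<in>Obj C. \<forall>f\<in>Hom C X Y. \<forall>g\<in>Hom C X Y.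
       on_arr F (f \<boxplus>\<^bsub>C\<^esub> g) = on_arr F f \<boxplus>\<^bsub>D\<^esub> on_arr F g)"

text \<open>
  The family \<open>P\<close> is indexed by the objects of \<open>C\<close> because \<open>F\<close> need not be injective on objects.
\<close>

definition separable_wrt ::
  "('o1, 'm1, 'x) category_scheme \<Rightarrow> ('o2, 'm2, 'y) category_scheme \<Rightarrow>
   ('o3, 'm3, 'z) category_scheme \<Rightarrow> ('o1, 'm1, 'o2, 'm2) functor_data \<Rightarrow>
   ('o1, 'm1, 'o3, 'm3) functor_data \<Rightarrow> bool" where
  "separable_wrt C D E F H \<longleftrightarrow> (\<exists>P :: 'o1 \<Rightarrow> 'o1 \<Rightarrow> 'm2 \<Rightarrow> 'm3.
    (\<forall>X\<in>Obj C. \<forall>Y\<in>Obj C. \<forall>h\<in>Hom D (on_obj F X) (on_obj F Y).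
       P X Y h \<in> Hom E (on_obj H X) (on_obj H Y)) \<and>
    (\<forall>X\<in>Obj C. \<forall>Y\<in>Obj C. \<forall>Z\<in>Obj C. \<forall>T\<in>Obj C.
       \<forall>u\<in>Hom C X Y. \<forall>v\<in>Hom C Z T. \<forall>h\<in>Hom D (on_obj F Y) (on_obj F Z).
       P X T (on_arr F v \<cdot>\<^bsub>D\<^esub> h \<cdot>\<^bsub>D\<^esub> on_arr F u) = on_arr H v \<cdot>\<^bsub>E\<^esub> P Y Z h \<cdot>\<^bsub>E\<^esub> on_arr H u) \<and>
    (\<forall>X\<in>Obj C. \<forall>Y\<in>Obj C. \<forall>f\<in>Hom C X Y. P X Y (on_arr F f) = on_arr H f))"

end

theory Submission
  imports Defs
begin

text \<open>
  Let \<open>P\<close> be the natural family that witnesses the separability of \<open>F\<close> relative to \<open>H\<close>. If \<open>r\<close> is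
  a left inverse of \<open>F f\<close>, naturality gives \<open>P r \<cdot> H f = P (r \<cdot> F f) = P (F 1) = H 1 = 1\<close>, and
  right inverses are transported in the same way. This part is pure category theory.

  Split exactness asks for more than the one-sided inverses: \<open>H f\<close> and \<open>H g\<close> must still form an
  exact sequence, although \<open>H\<close> need not preserve exactness. The way out is that split exactness is
  equational: in a preadditive category with a zero object, \<open>f\<close> and \<open>g\<close> form a split exact
  sequence if and only if they are the first injection and the second projection of a biproduct
  (\<open>biproduct_of_split_exact\<close>, \<open>split_exact_of_biproduct\<close>). Let \<open>r\<close> and \<open>s\<close> be the other
  projection and injection of such a biproduct in \<open>D\<close>. Naturality transports \<open>r \<cdot> F f = 1\<close> and
  \<open>F g \<cdot> s = 1\<close> to \<open>E\<close>, and \<open>H g \<cdot> H f = 0\<close> because \<open>H\<close> is additive. The decomposition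
  \<open>F f \<cdot> r + s \<cdot> F g = 1\<close> involves a sum, so its transport needs \<open>P\<close> to be additive. This follows
  from naturality once \<open>C\<close> has biproducts and \<open>F\<close> and \<open>H\<close> are additive (\<open>P_madd\<close>): two parallel
  arrows \<open>a\<close> and \<open>b\<close> are the restrictions of a single arrow \<open>h\<close> out of a biproduct along its two
  injections, and \<open>a + b\<close> is the restriction of the same \<open>h\<close> along the diagonal. The last
  equation, \<open>P r \<cdot> P s = 0\<close>, is a consequence of the others (\<open>is_biproductI\<close>).
\<close>

section \<open>Arithmetic of arrows in preadditive categories\<close>

lemma HomI: "\<lbrakk>f \<in> Arr C; src C f = X; tgt C f = Y\<rbrakk> \<Longrightarrow> f \<in> Hom C X Y"
  by (simp add: Hom_def)

lemma HomD:
  assumes "f \<in> Hom C X Y"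
  shows "f \<in> Arr C" "src C f = X" "tgt C f = Y"
  using assms by (simp_all add: Hom_def)

lemma (in category) Hom_Obj:
  assumes "f \<in> Hom C X Y"
  shows "X \<in> Obj C" "Y \<in> Obj C"
  using assms src_Obj tgt_Obj by (auto simp: Hom_def)

context preadditive_category
begin

lemma zero_Hom: "\<lbrakk>X \<in> Obj C; Y \<in> Obj C\<rbrakk> \<Longrightarrow> zero_arr C X Y \<in> Hom C X Y"
  using monoid.one_closed[OF comm_monoid.axioms(1)[OF comm_group.axioms(1)[OF Hom_comm_group]]]
  by (simp add: Hom_group_def)

lemma madd_Hom:
  assumes "a \<in> Hom C X Y" "b \<in> Hom C X Y"
  shows "a \<boxplus> b \<in> Hom C X Y"
proof -
  interpret G: comm_group "Hom_group C X Y"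
    using Hom_comm_group Hom_Obj assms by blast
  show ?thesis using G.m_closed[of a b] assms by (simp add: Hom_group_def)
qed

lemma madd_assoc:
  assumes "a \<in> Hom C X Y" "b \<in> Hom C X Y" "c \<in> Hom C X Y"
  shows "(a \<boxplus> b) \<boxplus> c = a \<boxplus> (b \<boxplus> c)"
proof -
  interpret G: comm_group "Hom_group C X Y"
    using Hom_comm_group Hom_Obj assms by blast
  show ?thesis using G.m_assoc[of a b c] assms by (simp add: Hom_group_def)
qed

lemma madd_comm:
  assumes "a \<in> Hom C X Y" "b \<in> Hom C X Y"
  shows "a \<boxplus> b = b \<boxplus> a"
proof -
  interpret G: comm_group "Hom_group C X Y"
    using Hom_comm_group Hom_Obj assms by blast
  show ?thesis using G.m_comm[of a b] assms by (simp add: Hom_group_def)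
qed

lemma madd_zero:
  assumes "a \<in> Hom C X Y"
  shows "a \<boxplus> zero_arr C X Y = a" "zero_arr C X Y \<boxplus> a = a"
proof -
  interpret G: comm_group "Hom_group C X Y"
    using Hom_comm_group Hom_Obj assms by blast
  show "a \<boxplus> zero_arr C X Y = a" "zero_arr C X Y \<boxplus> a = a"
    using G.r_one[of a] G.l_one[of a] assms by (simp_all add: Hom_group_def)
qed

lemma ex_negative:
  assumes "a \<in> Hom C X Y"
  obtains n where "n \<in> Hom C X Y" "n \<boxplus> a = zero_arr C X Y"
proof -
  interpret G: comm_group "Hom_group C X Y"
    using Hom_comm_group Hom_Obj assms by blast
  show thesis
    using that[of "inv\<^bsub>Hom_group C X Y\<^esub> a"] G.inv_closed[of a] G.l_inv[of a] assms
    by (simp add: Hom_group_def)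
qed

lemma madd_left_cancel:
  assumes "a \<in> Hom C X Y" "b \<in> Hom C X Y" "c \<in> Hom C X Y" "a \<boxplus> b = a \<boxplus> c"
  shows "b = c"
proof -
  interpret G: comm_group "Hom_group C X Y"
    using Hom_comm_group Hom_Obj assms by blast
  show ?thesis using G.Units_l_cancel[of a b c] G.Units_eq assms by (simp add: Hom_group_def)
qed

lemma comp_zero:
  assumes "g \<in> Hom C Y Z" "X \<in> Obj C"
  shows "g \<cdot> zero_arr C X Y = zero_arr C X Z"
proof -
  have Y: "Y \<in> Obj C" and Z: "Z \<in> Obj C" using Hom_Obj assms by auto
  let ?z = "g \<cdot> zero_arr C X Y"
  note z = zero_Hom[OF assms(2) Y]
  have h: "?z \<in> Hom C X Z" using comp_Hom z assms(1) .
  have "?z \<boxplus> ?z = ?z \<boxplus> zero_arr C X Z"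
    using comp_distrib_left[OF z z assms(1)] madd_zero[OF z] madd_zero[OF h] by simp
  then show ?thesis using madd_left_cancel[OF h h zero_Hom[OF assms(2) Z]] by simp
qed

lemma zero_comp:
  assumes "f \<in> Hom C X Y" "Z \<in> Obj C"
  shows "zero_arr C Y Z \<cdot> f = zero_arr C X Z"
proof -
  have X: "X \<in> Obj C" and Y: "Y \<in> Obj C" using Hom_Obj assms by auto
  let ?z = "zero_arr C Y Z \<cdot> f"
  note z = zero_Hom[OF Y assms(2)]
  have h: "?z \<in> Hom C X Z" using comp_Hom assms(1) z .
  have "?z \<boxplus> ?z = ?z \<boxplus> zero_arr C X Z"
    using comp_distrib_right[OF assms(1) z z] madd_zero[OF z] madd_zero[OF h] by simp
  then show ?thesis using madd_left_cancel[OF h h zero_Hom[OF X assms(2)]] by simp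
qed

lemma to_zero_object_unique:
  assumes "is_zero_object C N" "a \<in> Hom C X N" "b \<in> Hom C X N"
  shows "a = b"
  using assms Hom_Obj(1)[OF assms(2)] unfolding is_zero_object_def by blast

lemma from_zero_object_unique:
  assumes "is_zero_object C N" "a \<in> Hom C N X" "b \<in> Hom C N X"
  shows "a = b"
  using assms Hom_Obj(2)[OF assms(2)] unfolding is_zero_object_def by blast

section \<open>Split exact sequences are biproducts\<close>

text \<open>
  If \<open>k\<close> is the kernel through which exactness is witnessed, \<open>f\<close> factors through \<open>k\<close> because the
  cokernel of \<open>f\<close> kills it, and \<open>g\<close> kills \<open>k\<close>.
\<close>

lemma exact_at_comp_zero:
  assumes "exact_at C f g"
  shows "g \<cdot> f = zero_arr C (src C f) (tgt C g)"
proof -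
  obtain c k where c: "is_cokernel C c f" and kc: "is_kernel C k c" and kg: "is_kernel C k g"
    and tgt: "tgt C f = src C g"
    using assms unfolding exact_at_def by blast
  have f: "f \<in> Hom C (src C f) (src C c)"
    using c unfolding is_cokernel_def by (simp add: HomI)
  then have X: "src C f \<in> Obj C" by (rule Hom_Obj)
  have "c \<cdot> f = zero_arr C (src C f) (tgt C c)" using c by (simp add: is_cokernel_def)
  then obtain u where u: "u \<in> Hom C (src C f) (src C k)" "k \<cdot> u = f"
    using kc f X unfolding is_kernel_def by blast
  have k: "k \<in> Hom C (src C k) (src C g)" and g: "g \<in> Hom C (src C g) (tgt C g)"
    and gk: "g \<cdot> k = zero_arr C (src C k) (tgt C g)"
    using kg unfolding is_kernel_def by (simp_all add: HomI)
  have "g \<cdot> f = (g \<cdot> k) \<cdot> u" using comp_assoc[OF u(1) k g] u(2) by simp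
  then show ?thesis using gk zero_comp[OF u(1) Hom_Obj(2)[OF g]] by simp
qed

text \<open>
  The vanishing of \<open>p \<cdot> j\<close> is implied by the other biproduct equations: composing the
  decomposition of the identity with \<open>j\<close> gives \<open>i \<cdot> (p \<cdot> j) = 0\<close>, and \<open>i\<close> has a left inverse.
\<close>

lemma is_biproductI:
  assumes i: "i \<in> Hom C X B" and j: "j \<in> Hom C Y B" and p: "p \<in> Hom C B X" and q: "q \<in> Hom C B Y"
    and pi: "p \<cdot> i = ident C X" and qj: "q \<cdot> j = ident C Y" and qi: "q \<cdot> i = zero_arr C X Y"
    and sum: "(i \<cdot> p) \<boxplus> (j \<cdot> q) = ident C B"
  shows "is_biproduct C X Y B i j p q"
proof -
  have X: "X \<in> Obj C" and B: "B \<in> Obj C" and Y: "Y \<in> Obj C" using Hom_Obj i j by auto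
  have pj: "p \<cdot> j \<in> Hom C Y X" using comp_Hom j p .
  have ip: "i \<cdot> p \<in> Hom C B B" and jq: "j \<cdot> q \<in> Hom C B B"
    using comp_Hom i j p q by blast+
  have ipj: "i \<cdot> (p \<cdot> j) \<in> Hom C Y B" using comp_Hom pj i .
  have "j \<boxplus> (i \<cdot> (p \<cdot> j)) = (i \<cdot> (p \<cdot> j)) \<boxplus> j" using madd_comm j ipj .
  also have "\<dots> = ((i \<cdot> p) \<boxplus> (j \<cdot> q)) \<cdot> j"
    using comp_distrib_right[OF j ip jq] comp_assoc[OF j p i] comp_assoc[OF j q j] qj
      comp_ident[OF j] by simp
  also have "\<dots> = j \<boxplus> zero_arr C Y B" using sum ident_comp[OF j] madd_zero[OF j] by simp
  finally have 0: "i \<cdot> (p \<cdot> j) = zero_arr C Y B"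
    using madd_left_cancel[OF j ipj zero_Hom[OF Y B]] by simp
  have "p \<cdot> j = (p \<cdot> i) \<cdot> (p \<cdot> j)" using pi ident_comp[OF pj] by simp
  also have "\<dots> = p \<cdot> (i \<cdot> (p \<cdot> j))" using comp_assoc[OF pj i p] .
  also have "\<dots> = zero_arr C Y X" using 0 comp_zero[OF p Y] by simp
  finally show ?thesis using assms B unfolding is_biproduct_def by simp
qed

text \<open>
  A left inverse \<open>r\<close> makes \<open>f\<close> a kernel of its cokernel, so exactness at the middle object says
  that every \<open>h\<close> killed by \<open>g\<close> satisfies \<open>h = f \<cdot> (r \<cdot> h)\<close>. For a right inverse \<open>s\<close> of \<open>g\<close> this
  applies to \<open>h = 1 - s \<cdot> g\<close>. The given \<open>r\<close> need not vanish on \<open>s\<close>, so the retraction is corrected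
  to \<open>r \<cdot> (1 - s \<cdot> g)\<close>.
\<close>

lemma biproduct_of_split_exact:
  assumes "exact_at C f g" and "has_left_inverse C f" and "has_right_inverse C g"
  obtains r s where "is_biproduct C (src C f) (tgt C g) (tgt C f) f s r g"
proof -
  let ?X = "src C f" and ?Y = "tgt C f" and ?Z = "tgt C g"
  obtain c k where c: "is_cokernel C c f" and kc: "is_kernel C k c" and kg: "is_kernel C k g"
    and tgt: "src C g = ?Y" and "f \<in> Arr C" "g \<in> Arr C"
    using assms(1) unfolding exact_at_def by metis
  then have f: "f \<in> Hom C ?X ?Y" and g: "g \<in> Hom C ?Y ?Z" by (simp_all add: HomI)
  obtain r where r: "r \<in> Hom C ?Y ?X" "r \<cdot> f = ident C ?X"
    using assms(2) unfolding has_left_inverse_def by blast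
  obtain s where s: "s \<in> Hom C ?Z ?Y" "g \<cdot> s = ident C ?Z"
    using assms(3) tgt unfolding has_right_inverse_def by auto
  have X: "?X \<in> Obj C" and Y: "?Y \<in> Obj C" and Z: "?Z \<in> Obj C" using Hom_Obj f g by auto
  note 1 = ident_Hom[OF Y]
  have gf: "g \<cdot> f = zero_arr C ?X ?Z" using exact_at_comp_zero assms(1) .
  have fr: "f \<cdot> r \<in> Hom C ?Y ?Y" and sg: "s \<cdot> g \<in> Hom C ?Y ?Y" using comp_Hom f r s g by blast+
  have frf: "(f \<cdot> r) \<cdot> f = f" using comp_assoc[OF f r(1) f] r(2) comp_ident[OF f] by simp
  have gsg: "g \<cdot> (s \<cdot> g) = g" using comp_assoc[OF g s(1) g] s(2) ident_comp[OF g] by simp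

  \<comment> \<open>\<open>m = 1 - f \<cdot> r\<close> kills \<open>f\<close>, hence factors through the cokernel \<open>c\<close> of \<open>f\<close>.\<close>
  obtain n where n: "n \<in> Hom C ?Y ?Y" "n \<boxplus> (f \<cdot> r) = zero_arr C ?Y ?Y"
    using ex_negative[OF fr] .
  define m where "m = ident C ?Y \<boxplus> n"
  have m: "m \<in> Hom C ?Y ?Y" unfolding m_def using madd_Hom 1 n(1) .
  have m_fr: "m \<boxplus> (f \<cdot> r) = ident C ?Y"
    unfolding m_def using madd_assoc[OF 1 n(1) fr] n(2) madd_zero[OF 1] by simp
  have mf: "m \<cdot> f \<in> Hom C ?X ?Y" using comp_Hom f m .
  have "f \<boxplus> (m \<cdot> f) = (m \<cdot> f) \<boxplus> f" using madd_comm f mf .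
  also have "\<dots> = (m \<boxplus> (f \<cdot> r)) \<cdot> f" using comp_distrib_right[OF f m fr] frf by simp
  also have "\<dots> = f \<boxplus> zero_arr C ?X ?Y" using m_fr ident_comp[OF f] madd_zero[OF f] by simp
  finally have "m \<cdot> f = zero_arr C ?X ?Y"
    using madd_left_cancel[OF f mf zero_Hom[OF X Y]] by simp
  then obtain w where w: "w \<in> Hom C (tgt C c) ?Y" "w \<cdot> c = m"
    using c m Y unfolding is_cokernel_def by blast
  have cH: "c \<in> Hom C ?Y (tgt C c)"
    using c unfolding is_cokernel_def by (simp add: HomI)
  have retract: "f \<cdot> (r \<cdot> h) = h" if h: "h \<in> Hom C T ?Y" and gh: "g \<cdot> h = zero_arr C T ?Z" for h T
  proof -
    have T: "T \<in> Obj C" using Hom_Obj h by blast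
    obtain u where u: "u \<in> Hom C T (src C k)" "k \<cdot> u = h"
      using kg h gh T tgt unfolding is_kernel_def by metis
    have k: "k \<in> Hom C (src C k) ?Y" and ck: "c \<cdot> k = zero_arr C (src C k) (tgt C c)"
      using kc cH unfolding is_kernel_def by (simp_all add: Hom_def)
    have "c \<cdot> h = (c \<cdot> k) \<cdot> u" using comp_assoc[OF u(1) k cH] u(2) by simp
    also have "\<dots> = zero_arr C T (tgt C c)"
      using ck zero_comp[OF u(1) Hom_Obj(2)[OF cH]] by simp
    finally have "m \<cdot> h = zero_arr C T ?Y"
      using comp_assoc[OF h cH w(1)] w(2) comp_zero[OF w(1) T] by simp
    then have "(m \<boxplus> (f \<cdot> r)) \<cdot> h = f \<cdot> (r \<cdot> h)"
      using comp_distrib_right[OF h m fr] comp_assoc[OF h r(1) f]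
        madd_zero(2)[OF comp_Hom[OF comp_Hom[OF h r(1)] f]] by simp
    then show ?thesis using m_fr ident_comp[OF h] by simp
  qed

  \<comment> \<open>\<open>d = 1 - s \<cdot> g\<close> is killed by \<open>g\<close>, hence factors through \<open>f\<close>.\<close>
  obtain n' where n': "n' \<in> Hom C ?Y ?Y" "n' \<boxplus> (s \<cdot> g) = zero_arr C ?Y ?Y"
    using ex_negative[OF sg] .
  define d where "d = ident C ?Y \<boxplus> n'"
  have d: "d \<in> Hom C ?Y ?Y" unfolding d_def using madd_Hom 1 n'(1) .
  have d_sg: "d \<boxplus> (s \<cdot> g) = ident C ?Y"
    unfolding d_def using madd_assoc[OF 1 n'(1) sg] n'(2) madd_zero[OF 1] by simp
  have gd: "g \<cdot> d \<in> Hom C ?Y ?Z" using comp_Hom d g .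
  have "g \<boxplus> (g \<cdot> d) = (g \<cdot> d) \<boxplus> g" using madd_comm g gd .
  also have "\<dots> = g \<cdot> (d \<boxplus> (s \<cdot> g))" using comp_distrib_left[OF d sg g] gsg by simp
  also have "\<dots> = g \<boxplus> zero_arr C ?Y ?Z" using d_sg comp_ident[OF g] madd_zero[OF g] by simp
  finally have "g \<cdot> d = zero_arr C ?Y ?Z"
    using madd_left_cancel[OF g gd zero_Hom[OF Y Z]] by simp
  then have frd: "f \<cdot> (r \<cdot> d) = d" using retract[OF d] by simp
  have sgf: "(s \<cdot> g) \<cdot> f = zero_arr C ?X ?Y"
    using comp_assoc[OF f g s(1)] gf comp_zero[OF s(1) X] by simp
  have df: "d \<cdot> f \<in> Hom C ?X ?Y" using comp_Hom f d .
  have "d \<cdot> f = (d \<boxplus> (s \<cdot> g)) \<cdot> f"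
    using comp_distrib_right[OF f d sg] sgf madd_zero[OF df] by simp
  then have "d \<cdot> f = f" using d_sg ident_comp[OF f] by simp
  then have rdf: "(r \<cdot> d) \<cdot> f = ident C ?X" using comp_assoc[OF f d r(1)] r(2) by simp
  have "is_biproduct C ?X ?Z ?Y f s (r \<cdot> d) g"
    using is_biproductI[OF f s(1) comp_Hom[OF d r(1)] g rdf s(2) gf] frd d_sg by simp
  then show thesis by (rule that)
qed

text \<open>
  The injection \<open>i\<close> is a kernel of \<open>q\<close> and \<open>q\<close> is a cokernel of \<open>i\<close>, with the factorisations given
  by composing with \<open>p\<close> and \<open>j\<close>; at the two outer objects, exactness against the zero object only
  records that \<open>i\<close> is mono and \<open>q\<close> is epi.
\<close>

lemma split_exact_of_biproduct:
  assumes N: "is_zero_object C N" and bi: "is_biproduct C X Y B i j p q"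
  shows "split_exact C i q"
proof -
  have i: "i \<in> Hom C X B" and j: "j \<in> Hom C Y B" and p: "p \<in> Hom C B X" and q: "q \<in> Hom C B Y"
    and pi: "p \<cdot> i = ident C X" and qj: "q \<cdot> j = ident C Y" and qi: "q \<cdot> i = zero_arr C X Y"
    and sum: "(i \<cdot> p) \<boxplus> (j \<cdot> q) = ident C B"
    using bi unfolding is_biproduct_def by simp_all
  note [simp] = HomD[OF i] HomD[OF j] HomD[OF p] HomD[OF q]
  have X: "X \<in> Obj C" and B: "B \<in> Obj C" and Y: "Y \<in> Obj C" using Hom_Obj i j by auto
  have N': "N \<in> Obj C" using N by (simp add: is_zero_object_def)
  note [simp] = HomD[OF zero_Hom[OF N' X]] HomD[OF zero_Hom[OF Y N']]
    HomD[OF ident_Hom[OF X]] HomD[OF ident_Hom[OF Y]]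
  have ip: "i \<cdot> p \<in> Hom C B B" and jq: "j \<cdot> q \<in> Hom C B B"
    using comp_Hom i j p q by blast+
  have mono: "p \<cdot> (i \<cdot> u) = u" if "u \<in> Hom C T X" for u T
    using comp_assoc[OF that i p] pi ident_comp[OF that] by simp
  have epi: "(u \<cdot> q) \<cdot> j = u" if "u \<in> Hom C Y T" for u T
    using comp_assoc[OF j q that] qj comp_ident[OF that] by simp
  have ker: "is_kernel C i q"
    unfolding is_kernel_def
  proof (intro conjI ballI impI)
    fix T h assume T: "T \<in> Obj C" and h: "h \<in> Hom C T (src C q)"
      and qh: "q \<cdot> h = zero_arr C T (tgt C q)"
    have h': "h \<in> Hom C T B" using h by simp
    have ph: "p \<cdot> h \<in> Hom C T X" using comp_Hom h' p .
    have "h = ((i \<cdot> p) \<boxplus> (j \<cdot> q)) \<cdot> h" using sum ident_comp[OF h'] by simp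
    also have "\<dots> = (i \<cdot> (p \<cdot> h)) \<boxplus> zero_arr C T B"
      using comp_distrib_right[OF h' ip jq] comp_assoc[OF h' p i] comp_assoc[OF h' q j]
        qh comp_zero[OF j T] by simp
    also have "\<dots> = i \<cdot> (p \<cdot> h)" using madd_zero[OF comp_Hom[OF ph i]] by simp
    finally have "i \<cdot> (p \<cdot> h) = h" ..
    then show "\<exists>!u. u \<in> Hom C T (src C i) \<and> i \<cdot> u = h"
      using ph mono by (intro ex1I[of _ "p \<cdot> h"]) auto
  qed (simp_all add: qi)
  have coker: "is_cokernel C q i"
    unfolding is_cokernel_def
  proof (intro conjI ballI impI)
    fix T h assume T: "T \<in> Obj C" and h: "h \<in> Hom C (tgt C i) T"
      and hi: "h \<cdot> i = zero_arr C (src C i) T"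
    have h': "h \<in> Hom C B T" using h by simp
    have hj: "h \<cdot> j \<in> Hom C Y T" using comp_Hom j h' .
    have "h = h \<cdot> ((i \<cdot> p) \<boxplus> (j \<cdot> q))" using sum comp_ident[OF h'] by simp
    also have "\<dots> = zero_arr C B T \<boxplus> ((h \<cdot> j) \<cdot> q)"
      using comp_distrib_left[OF ip jq h'] comp_assoc[OF p i h'] comp_assoc[OF q j h']
        hi zero_comp[OF p T] by simp
    also have "\<dots> = (h \<cdot> j) \<cdot> q" using madd_zero[OF comp_Hom[OF q hj]] by simp
    finally have "(h \<cdot> j) \<cdot> q = h" ..
    then show "\<exists>!u. u \<in> Hom C (tgt C q) T \<and> u \<cdot> q = h"
      using hj epi by (intro ex1I[of _ "h \<cdot> j"]) auto
  qed (simp_all add: qi)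
  have zero_ker: "is_kernel C (zero_arr C N X) a"
    if a: "a \<in> Hom C X A" and b: "b \<in> Hom C A X" and ba: "b \<cdot> a = ident C X" for a b A
    unfolding is_kernel_def
  proof (intro conjI ballI impI)
    fix T h assume T: "T \<in> Obj C" and h: "h \<in> Hom C T (src C a)"
      and ah: "a \<cdot> h = zero_arr C T (tgt C a)"
    have h': "h \<in> Hom C T X" using h HomD[OF a] by simp
    have "h = b \<cdot> (a \<cdot> h)" using comp_assoc[OF h' a b] ba ident_comp[OF h'] by simp
    also have "\<dots> = zero_arr C T X" using ah HomD[OF a] comp_zero[OF b T] by simp
    also have "\<dots> = zero_arr C N X \<cdot> zero_arr C T N" using zero_comp[OF zero_Hom[OF T N'] X] by simp
    finally have "zero_arr C N X \<cdot> zero_arr C T N = h" ..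
    then show "\<exists>!u. u \<in> Hom C T (src C (zero_arr C N X)) \<and> zero_arr C N X \<cdot> u = h"
      using zero_Hom[OF T N'] to_zero_object_unique[OF N]
      by (intro ex1I[of _ "zero_arr C T N"]) auto
  qed (use HomD[OF a] comp_zero[OF a N'] in simp_all)
  have zero_coker: "is_cokernel C (zero_arr C Y N) q"
    unfolding is_cokernel_def
  proof (intro conjI ballI impI)
    fix T h assume T: "T \<in> Obj C" and h: "h \<in> Hom C (tgt C q) T"
      and hq: "h \<cdot> q = zero_arr C (src C q) T"
    have h': "h \<in> Hom C Y T" using h by simp
    have "h = (h \<cdot> q) \<cdot> j" using epi[OF h'] by simp
    also have "\<dots> = zero_arr C Y T" using hq zero_comp[OF j T] by simp
    also have "\<dots> = zero_arr C N T \<cdot> zero_arr C Y N" using comp_zero[OF zero_Hom[OF N' T] Y] by simp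
    finally have "zero_arr C N T \<cdot> zero_arr C Y N = h" ..
    then show "\<exists>!u. u \<in> Hom C (tgt C (zero_arr C Y N)) T \<and> u \<cdot> zero_arr C Y N = h"
      using zero_Hom[OF N' T] from_zero_object_unique[OF N]
      by (intro ex1I[of _ "zero_arr C N T"]) auto
  qed (use zero_comp[OF q N'] in simp_all)
  have id_coker: "is_cokernel C (ident C X) (zero_arr C N X)"
    unfolding is_cokernel_def
  proof (intro conjI ballI impI)
    fix T h assume "T \<in> Obj C" and "h \<in> Hom C (tgt C (zero_arr C N X)) T"
    then have "h \<in> Hom C X T" by simp
    then show "\<exists>!u. u \<in> Hom C (tgt C (ident C X)) T \<and> u \<cdot> ident C X = h"
      using comp_ident by (intro ex1I[of _ h]) auto
  qed (use ident_comp[OF zero_Hom[OF N' X]] in simp_all)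
  have id_ker: "is_kernel C (ident C Y) (zero_arr C Y N)"
    unfolding is_kernel_def
  proof (intro conjI ballI impI)
    fix T h assume "T \<in> Obj C" and "h \<in> Hom C T (src C (zero_arr C Y N))"
    then have "h \<in> Hom C T Y" by simp
    then show "\<exists>!u. u \<in> Hom C T (src C (ident C Y)) \<and> ident C Y \<cdot> u = h"
      using ident_comp by (intro ex1I[of _ h]) auto
  qed (use comp_ident[OF zero_Hom[OF Y N']] in simp_all)
  have "exact_at C (zero_arr C N X) i"
    unfolding exact_at_def
    using id_coker zero_ker[OF ident_Hom[OF X] ident_Hom[OF X] ident_comp[OF ident_Hom[OF X]]]
      zero_ker[OF i p pi] by auto
  moreover have "exact_at C i q"
    unfolding exact_at_def using ker coker by auto
  moreover have "exact_at C q (zero_arr C Y N)"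
    unfolding exact_at_def using zero_coker id_ker by auto
  ultimately have "short_exact C i q" unfolding short_exact_def using N by auto
  moreover have "has_left_inverse C i" "has_right_inverse C q"
    unfolding has_left_inverse_def has_right_inverse_def using p pi j qj by auto
  ultimately show ?thesis by (simp add: split_exact_def)
qed

end

section \<open>Transport along a separability family\<close>

lemma covariant_functorD:
  assumes "covariant_functor C D F" and "category C"
  shows "X \<in> Obj C \<Longrightarrow> on_obj F X \<in> Obj D"
    and "f \<in> Hom C X Y \<Longrightarrow> on_arr F f \<in> Hom D (on_obj F X) (on_obj F Y)"
    and "X \<in> Obj C \<Longrightarrow> on_arr F (ident C X) = ident D (on_obj F X)"
    and "\<lbrakk>f \<in> Hom C X Y; g \<in> Hom C Y Z\<rbrakk> \<Longrightarrow> on_arr F (g \<cdot>\<^bsub>C\<^esub> f) = on_arr F g \<cdot>\<^bsub>D\<^esub> on_arr F f"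
  using assms category.Hom_Obj[OF assms(2)] unfolding covariant_functor_def by blast+

lemma additive_functor_zero:
  assumes "additive_functor C D F" and "preadditive_category C" and "preadditive_category D"
    and X: "X \<in> Obj C" and Y: "Y \<in> Obj C"
  shows "on_arr F (zero_arr C X Y) = zero_arr D (on_obj F X) (on_obj F Y)"
proof -
  interpret C: preadditive_category C by fact
  interpret D: preadditive_category D by fact
  have F: "covariant_functor C D F" using assms(1) by (simp add: additive_functor_def)
  let ?z = "zero_arr C X Y"
  note z = C.zero_Hom[OF X Y]
  note Fz = covariant_functorD(2)[OF F C.category_axioms z]
  have "on_arr F ?z \<boxplus>\<^bsub>D\<^esub> on_arr F ?z = on_arr F ?z"
    using assms(1) X Y z C.madd_zero[OF z] unfolding additive_functor_def by metis
  then have "on_arr F ?z \<boxplus>\<^bsub>D\<^esub> on_arr F ?z =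
      on_arr F ?z \<boxplus>\<^bsub>D\<^esub> zero_arr D (on_obj F X) (on_obj F Y)"
    using D.madd_zero[OF Fz] by simp
  then show ?thesis
    using D.madd_left_cancel[OF Fz Fz] D.zero_Hom D.Hom_Obj[OF Fz] by blast
qed

locale separability_family =
  C: category C + D: category D + E: category E
  for C :: "('o1, 'm1, 'x) category_scheme"
    and D :: "('o2, 'm2, 'y) category_scheme"
    and E :: "('o3, 'm3, 'z) category_scheme" +
  fixes F :: "('o1, 'm1, 'o2, 'm2) functor_data"
    and H :: "('o1, 'm1, 'o3, 'm3) functor_data"
    and P :: "'o1 \<Rightarrow> 'o1 \<Rightarrow> 'm2 \<Rightarrow> 'm3"
  assumes F: "covariant_functor C D F"
    and H: "covariant_functor C E H"
    and P_Hom: "\<lbrakk>X \<in> Obj C; Y \<in> Obj C; h \<in> Hom D (on_obj F X) (on_obj F Y)\<rbrakk>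
      \<Longrightarrow> P X Y h \<in> Hom E (on_obj H X) (on_obj H Y)"
    and P_natural: "\<lbrakk>u \<in> Hom C X Y; v \<in> Hom C Z T; h \<in> Hom D (on_obj F Y) (on_obj F Z)\<rbrakk>
      \<Longrightarrow> P X T (on_arr F v \<cdot>\<^bsub>D\<^esub> h \<cdot>\<^bsub>D\<^esub> on_arr F u) = on_arr H v \<cdot>\<^bsub>E\<^esub> P Y Z h \<cdot>\<^bsub>E\<^esub> on_arr H u"
    and P_F: "f \<in> Hom C X Y \<Longrightarrow> P X Y (on_arr F f) = on_arr H f"
begin

lemmas F_Obj = covariant_functorD(1)[OF F C.category_axioms]
lemmas F_Hom = covariant_functorD(2)[OF F C.category_axioms]
lemmas F_ident = covariant_functorD(3)[OF F C.category_axioms]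
lemmas F_comp = covariant_functorD(4)[OF F C.category_axioms]
lemmas H_Obj = covariant_functorD(1)[OF H C.category_axioms]
lemmas H_Hom = covariant_functorD(2)[OF H C.category_axioms]
lemmas H_ident = covariant_functorD(3)[OF H C.category_axioms]
lemmas H_comp = covariant_functorD(4)[OF H C.category_axioms]

lemma P_ident: "X \<in> Obj C \<Longrightarrow> P X X (ident D (on_obj F X)) = ident E (on_obj H X)"
  using P_F[OF C.ident_Hom] F_ident H_ident by simp

lemma P_comp_F:
  assumes u: "u \<in> Hom C X Y" and Z: "Z \<in> Obj C" and h: "h \<in> Hom D (on_obj F Y) (on_obj F Z)"
  shows "P X Z (h \<cdot>\<^bsub>D\<^esub> on_arr F u) = P Y Z h \<cdot>\<^bsub>E\<^esub> on_arr H u"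
  using P_natural[OF u C.ident_Hom[OF Z] h] F_ident[OF Z] H_ident[OF Z] D.ident_comp[OF h]
    E.ident_comp[OF P_Hom[OF C.Hom_Obj(2)[OF u] Z h]] by simp

lemma P_F_comp:
  assumes v: "v \<in> Hom C Y Z" and X: "X \<in> Obj C" and h: "h \<in> Hom D (on_obj F X) (on_obj F Y)"
  shows "P X Z (on_arr F v \<cdot>\<^bsub>D\<^esub> h) = on_arr H v \<cdot>\<^bsub>E\<^esub> P X Y h"
proof -
  have Ph: "P X Y h \<in> Hom E (on_obj H X) (on_obj H Y)"
    using P_Hom X C.Hom_Obj(1)[OF v] h .
  show ?thesis
    using P_natural[OF C.ident_Hom[OF X] v h] F_ident[OF X] H_ident[OF X]
      D.comp_ident[OF D.comp_Hom[OF h F_Hom[OF v]]] E.comp_ident[OF E.comp_Hom[OF Ph H_Hom[OF v]]]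
    by simp
qed

lemma has_left_inverse_transport:
  assumes f: "f \<in> Hom C X Y" and "has_left_inverse D (on_arr F f)"
  shows "has_left_inverse E (on_arr H f)"
proof -
  note X = C.Hom_Obj(1)[OF f] and Y = C.Hom_Obj(2)[OF f]
  obtain r where r: "r \<in> Hom D (on_obj F Y) (on_obj F X)"
    "r \<cdot>\<^bsub>D\<^esub> on_arr F f = ident D (on_obj F X)"
    using assms(2) HomD[OF F_Hom[OF f]] unfolding has_left_inverse_def by auto
  have "P Y X r \<cdot>\<^bsub>E\<^esub> on_arr H f = ident E (on_obj H X)"
    using P_comp_F[OF f X r(1)] r(2) P_ident[OF X] by simp
  then show ?thesis
    using P_Hom[OF Y X r(1)] HomD[OF H_Hom[OF f]] unfolding has_left_inverse_def by auto
qed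

lemma has_right_inverse_transport:
  assumes g: "g \<in> Hom C Y Z" and "has_right_inverse D (on_arr F g)"
  shows "has_right_inverse E (on_arr H g)"
proof -
  note Y = C.Hom_Obj(1)[OF g] and Z = C.Hom_Obj(2)[OF g]
  obtain s where s: "s \<in> Hom D (on_obj F Z) (on_obj F Y)"
    "on_arr F g \<cdot>\<^bsub>D\<^esub> s = ident D (on_obj F Z)"
    using assms(2) HomD[OF F_Hom[OF g]] unfolding has_right_inverse_def by auto
  have "on_arr H g \<cdot>\<^bsub>E\<^esub> P Z Y s = ident E (on_obj H Z)"
    using P_F_comp[OF g Z s(1)] s(2) P_ident[OF Z] by simp
  then show ?thesis
    using P_Hom[OF Z Y s(1)] HomD[OF H_Hom[OF g]] unfolding has_right_inverse_def by auto
qed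

end

locale additive_separability_family =
  separability_family C D E F H P +
  C: preadditive_category C + D: preadditive_category D + E: preadditive_category E
  for C :: "('o1, 'm1, 'x) additive_structure_scheme"
    and D :: "('o2, 'm2, 'y) additive_structure_scheme"
    and E :: "('o3, 'm3, 'z) additive_structure_scheme"
    and F H P +
  assumes F_additive: "additive_functor C D F"
    and H_additive: "additive_functor C E H"
    and C_biproducts: "X \<in> Obj C \<Longrightarrow> \<exists>B i j p q. is_biproduct C X X B i j p q"
begin

lemmas F_zero = additive_functor_zero[OF F_additive C.preadditive_category_axioms
  D.preadditive_category_axioms]
lemmas H_zero = additive_functor_zero[OF H_additive C.preadditive_category_axioms
  E.preadditive_category_axioms]

lemma F_madd:
  "\<lbrakk>u \<in> Hom C X Y; v \<in> Hom C X Y\<rbrakk> \<Longrightarrow> on_arr F (u \<boxplus>\<^bsub>C\<^esub> v) = on_arr F u \<boxplus>\<^bsub>D\<^esub> on_arr F v"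
  using F_additive C.Hom_Obj unfolding additive_functor_def by blast

lemma H_madd:
  "\<lbrakk>u \<in> Hom C X Y; v \<in> Hom C X Y\<rbrakk> \<Longrightarrow> on_arr H (u \<boxplus>\<^bsub>C\<^esub> v) = on_arr H u \<boxplus>\<^bsub>E\<^esub> on_arr H v"
  using H_additive C.Hom_Obj unfolding additive_functor_def by blast

text \<open>
  On a biproduct of \<open>X\<close> with itself put \<open>h = a \<cdot> F p + b \<cdot> F q\<close>, so that \<open>h \<cdot> F i = a\<close> and
  \<open>h \<cdot> F j = b\<close>. Precomposing with \<open>F (i + j) = F i + F j\<close> gives \<open>a + b\<close>, and naturality turns this
  precomposition into \<open>P h \<cdot> H (i + j) = P h \<cdot> H i + P h \<cdot> H j = P a + P b\<close>.
\<close>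

lemma P_madd:
  assumes X: "X \<in> Obj C" and Y: "Y \<in> Obj C"
    and a: "a \<in> Hom D (on_obj F X) (on_obj F Y)" and b: "b \<in> Hom D (on_obj F X) (on_obj F Y)"
  shows "P X Y (a \<boxplus>\<^bsub>D\<^esub> b) = P X Y a \<boxplus>\<^bsub>E\<^esub> P X Y b"
proof -
  obtain B i j p q where bi: "is_biproduct C X X B i j p q" using C_biproducts[OF X] by blast
  then have B: "B \<in> Obj C" and i: "i \<in> Hom C X B" and j: "j \<in> Hom C X B"
    and p: "p \<in> Hom C B X" and q: "q \<in> Hom C B X"
    and pi: "p \<cdot>\<^bsub>C\<^esub> i = ident C X" and qj: "q \<cdot>\<^bsub>C\<^esub> j = ident C X"
    and pj: "p \<cdot>\<^bsub>C\<^esub> j = zero_arr C X X" and qi: "q \<cdot>\<^bsub>C\<^esub> i = zero_arr C X X"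
    unfolding is_biproduct_def by simp_all
  note Fi = F_Hom[OF i] and Fj = F_Hom[OF j] and Fp = F_Hom[OF p] and Fq = F_Hom[OF q]
  have Fpi: "on_arr F p \<cdot>\<^bsub>D\<^esub> on_arr F i = ident D (on_obj F X)"
    and Fqj: "on_arr F q \<cdot>\<^bsub>D\<^esub> on_arr F j = ident D (on_obj F X)"
    and Fpj: "on_arr F p \<cdot>\<^bsub>D\<^esub> on_arr F j = zero_arr D (on_obj F X) (on_obj F X)"
    and Fqi: "on_arr F q \<cdot>\<^bsub>D\<^esub> on_arr F i = zero_arr D (on_obj F X) (on_obj F X)"
    using F_comp[OF i p] F_comp[OF j q] F_comp[OF j p] F_comp[OF i q] pi qj pj qi
      F_ident[OF X] F_zero[OF X X] by simp_all
  note ap = D.comp_Hom[OF Fp a] and bq = D.comp_Hom[OF Fq b]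
  define h where "h = (a \<cdot>\<^bsub>D\<^esub> on_arr F p) \<boxplus>\<^bsub>D\<^esub> (b \<cdot>\<^bsub>D\<^esub> on_arr F q)"
  have h: "h \<in> Hom D (on_obj F B) (on_obj F Y)" unfolding h_def using D.madd_Hom ap bq .
  have hi: "h \<cdot>\<^bsub>D\<^esub> on_arr F i = a"
    unfolding h_def
    using D.comp_distrib_right[OF Fi ap bq] D.comp_assoc[OF Fi Fp a] D.comp_assoc[OF Fi Fq b]
      Fpi Fqi D.comp_ident[OF a] D.comp_zero[OF b F_Obj[OF X]] D.madd_zero[OF a] by simp
  have hj: "h \<cdot>\<^bsub>D\<^esub> on_arr F j = b"
    unfolding h_def
    using D.comp_distrib_right[OF Fj ap bq] D.comp_assoc[OF Fj Fp a] D.comp_assoc[OF Fj Fq b]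
      Fpj Fqj D.comp_ident[OF b] D.comp_zero[OF a F_Obj[OF X]] D.madd_zero[OF b] by simp
  have "a \<boxplus>\<^bsub>D\<^esub> b = h \<cdot>\<^bsub>D\<^esub> on_arr F (i \<boxplus>\<^bsub>C\<^esub> j)"
    using D.comp_distrib_left[OF Fi Fj h] hi hj F_madd[OF i j] by simp
  then have "P X Y (a \<boxplus>\<^bsub>D\<^esub> b) = P B Y h \<cdot>\<^bsub>E\<^esub> on_arr H (i \<boxplus>\<^bsub>C\<^esub> j)"
    using P_comp_F[OF C.madd_Hom[OF i j] Y h] by simp
  also have "\<dots> = (P B Y h \<cdot>\<^bsub>E\<^esub> on_arr H i) \<boxplus>\<^bsub>E\<^esub> (P B Y h \<cdot>\<^bsub>E\<^esub> on_arr H j)"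
    using H_madd[OF i j] E.comp_distrib_left[OF H_Hom[OF i] H_Hom[OF j] P_Hom[OF B Y h]] by simp
  also have "\<dots> = P X Y a \<boxplus>\<^bsub>E\<^esub> P X Y b"
    using P_comp_F[OF i Y h] P_comp_F[OF j Y h] hi hj by simp
  finally show ?thesis .
qed

lemma biproduct_transport:
  assumes f: "f \<in> Hom C X Y" and g: "g \<in> Hom C Y Z" and gf: "g \<cdot>\<^bsub>C\<^esub> f = zero_arr C X Z"
    and bi: "is_biproduct D (on_obj F X) (on_obj F Z) (on_obj F Y) (on_arr F f) s r (on_arr F g)"
  shows "is_biproduct E (on_obj H X) (on_obj H Z) (on_obj H Y)
    (on_arr H f) (P Z Y s) (P Y X r) (on_arr H g)"
proof -
  have X: "X \<in> Obj C" and Y: "Y \<in> Obj C" and Z: "Z \<in> Obj C" using C.Hom_Obj f g by auto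
  have s: "s \<in> Hom D (on_obj F Z) (on_obj F Y)" and r: "r \<in> Hom D (on_obj F Y) (on_obj F X)"
    and rf: "r \<cdot>\<^bsub>D\<^esub> on_arr F f = ident D (on_obj F X)"
    and gs: "on_arr F g \<cdot>\<^bsub>D\<^esub> s = ident D (on_obj F Z)"
    and sum: "(on_arr F f \<cdot>\<^bsub>D\<^esub> r) \<boxplus>\<^bsub>D\<^esub> (s \<cdot>\<^bsub>D\<^esub> on_arr F g) = ident D (on_obj F Y)"
    using bi unfolding is_biproduct_def by simp_all
  have "(on_arr H f \<cdot>\<^bsub>E\<^esub> P Y X r) \<boxplus>\<^bsub>E\<^esub> (P Z Y s \<cdot>\<^bsub>E\<^esub> on_arr H g) =
      P Y Y ((on_arr F f \<cdot>\<^bsub>D\<^esub> r) \<boxplus>\<^bsub>D\<^esub> (s \<cdot>\<^bsub>D\<^esub> on_arr F g))"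
    using P_F_comp[OF f Y r] P_comp_F[OF g Y s]
      P_madd[OF Y Y D.comp_Hom[OF r F_Hom[OF f]] D.comp_Hom[OF F_Hom[OF g] s]] by simp
  also have "\<dots> = ident E (on_obj H Y)" using sum P_ident[OF Y] by simp
  finally have sum': "(on_arr H f \<cdot>\<^bsub>E\<^esub> P Y X r) \<boxplus>\<^bsub>E\<^esub> (P Z Y s \<cdot>\<^bsub>E\<^esub> on_arr H g) =
    ident E (on_obj H Y)" .
  have rf': "P Y X r \<cdot>\<^bsub>E\<^esub> on_arr H f = ident E (on_obj H X)"
    using P_comp_F[OF f X r] rf P_ident[OF X] by simp
  have gs': "on_arr H g \<cdot>\<^bsub>E\<^esub> P Z Y s = ident E (on_obj H Z)"
    using P_F_comp[OF g Z s] gs P_ident[OF Z] by simp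
  have gf': "on_arr H g \<cdot>\<^bsub>E\<^esub> on_arr H f = zero_arr E (on_obj H X) (on_obj H Z)"
    using H_comp[OF f g] gf H_zero[OF X Z] by simp
  show ?thesis
    using E.is_biproductI[OF H_Hom[OF f] P_Hom[OF Z Y s] P_Hom[OF Y X r] H_Hom[OF g]
      rf' gs' gf' sum'] .
qed

lemma split_exact_transport:
  assumes "exact_at C f g" and N: "is_zero_object E N"
    and "split_exact D (on_arr F f) (on_arr F g)"
  shows "split_exact E (on_arr H f) (on_arr H g)"
proof -
  let ?X = "src C f" and ?Y = "tgt C f" and ?Z = "tgt C g"
  have f: "f \<in> Hom C ?X ?Y" and g: "g \<in> Hom C ?Y ?Z"
    using assms(1) unfolding exact_at_def by (simp_all add: HomI)
  have "exact_at D (on_arr F f) (on_arr F g)" "has_left_inverse D (on_arr F f)"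
    "has_right_inverse D (on_arr F g)"
    using assms(3) unfolding split_exact_def short_exact_def by auto
  then obtain r s where "is_biproduct D (on_obj F ?X) (on_obj F ?Z) (on_obj F ?Y)
      (on_arr F f) s r (on_arr F g)"
    using D.biproduct_of_split_exact HomD[OF F_Hom[OF f]] HomD[OF F_Hom[OF g]] by metis
  then show ?thesis
    using E.split_exact_of_biproduct[OF N]
      biproduct_transport[OF f g C.exact_at_comp_zero[OF assms(1)]] by blast
qed

end

section \<open>Separable functors and split exact sequences\<close>

theorem corollary3p5:
  fixes C :: "('o1, 'm1) additive_structure"
    and D :: "('o2, 'm2) additive_structure"
    and E :: "('o3, 'm3) additive_structure"
    and F :: "('o1, 'm1, 'o2, 'm2) functor_data"
    and H :: "('o1, 'm1, 'o3, 'm3) functor_data"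
    and f g :: 'm1
  assumes "abelian_category C" and "abelian_category D" and "abelian_category E"
    and "covariant_functor C D F" and "covariant_functor C E H"
    and "separable_wrt C D E F H"
    and "short_exact C f g"
  shows "(has_left_inverse D (on_arr F f) \<longrightarrow> has_left_inverse E (on_arr H f)) \<and>
         (has_right_inverse D (on_arr F g) \<longrightarrow> has_right_inverse E (on_arr H g)) \<and>
         (additive_functor C D F \<and> additive_functor C E H \<and>
            split_exact D (on_arr F f) (on_arr F g) \<longrightarrow>
          split_exact E (on_arr H f) (on_arr H g))"
proof -
  interpret C: abelian_category C by fact
  interpret D: abelian_category D by fact
  interpret E: abelian_category E by fact
  obtain P :: "'o1 \<Rightarrow> 'o1 \<Rightarrow> 'm2 \<Rightarrow> 'm3" where
    P_Hom: "\<forall>X\<in>Obj C. \<forall>Y\<in>Obj C. \<forall>h\<in>Hom D (on_obj F X) (on_obj F Y).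
      P X Y h \<in> Hom E (on_obj H X) (on_obj H Y)" and
    P_natural: "\<forall>X\<in>Obj C. \<forall>Y\<in>Obj C. \<forall>Z\<in>Obj C. \<forall>T\<in>Obj C.
      \<forall>u\<in>Hom C X Y. \<forall>v\<in>Hom C Z T. \<forall>h\<in>Hom D (on_obj F Y) (on_obj F Z).
      P X T (on_arr F v \<cdot>\<^bsub>D\<^esub> h \<cdot>\<^bsub>D\<^esub> on_arr F u) = on_arr H v \<cdot>\<^bsub>E\<^esub> P Y Z h \<cdot>\<^bsub>E\<^esub> on_arr H u" and
    P_F: "\<forall>X\<in>Obj C. \<forall>Y\<in>Obj C. \<forall>f\<in>Hom C X Y. P X Y (on_arr F f) = on_arr H f"
    using assms(6) unfolding separable_wrt_def by blast
  interpret S: separability_family C D E F H P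
  proof
    fix X Y Z T u v h
    assume "u \<in> Hom C X Y" "v \<in> Hom C Z T" "h \<in> Hom D (on_obj F Y) (on_obj F Z)"
    then show "P X T (on_arr F v \<cdot>\<^bsub>D\<^esub> h \<cdot>\<^bsub>D\<^esub> on_arr F u) = on_arr H v \<cdot>\<^bsub>E\<^esub> P Y Z h \<cdot>\<^bsub>E\<^esub> on_arr H u"
      using P_natural C.Hom_Obj[of u X Y] C.Hom_Obj[of v Z T] by simp
  next
    fix f X Y assume "f \<in> Hom C X Y"
    then show "P X Y (on_arr F f) = on_arr H f" using P_F C.Hom_Obj[of f X Y] by simp
  qed (use assms(4,5) P_Hom in simp_all)
  have ex: "exact_at C f g" using assms(7) unfolding short_exact_def by blast
  then have f: "f \<in> Hom C (src C f) (tgt C f)" and g: "g \<in> Hom C (src C g) (tgt C g)"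
    unfolding exact_at_def by (simp_all add: HomI)
  have "split_exact E (on_arr H f) (on_arr H g)"
    if "additive_functor C D F" "additive_functor C E H"
      "split_exact D (on_arr F f) (on_arr F g)"
  proof -
    interpret A: additive_separability_family C D E F H P
      by unfold_locales (use that C.biproducts in auto)
    obtain N where "is_zero_object E N" using E.zero_object by blast
    then show ?thesis using A.split_exact_transport ex that(3) by blast
  qed
  then show ?thesis
    using S.has_left_inverse_transport[OF f] S.has_right_inverse_transport[OF g] by blast
qed

end
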